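(* Let $\Omega$ be an exterior domain as in the context. There exists a constant $C>0$ depending only on $\Omega$ such that the following holds for every (measurable) vector field $\bar{\boldsymbol u}:\Omega\to\mathbb{R}^2$: if $$\sup_{\boldsymbol x\in\Omega}\big(|\boldsymbol x|\,|\bar{\boldsymbol u}(\boldsymbol x)|\big)\le\frac\delta C$$ for some $\delta>0$, then for any centrally symmetric $\boldsymbol v\in\dot H^1_{0,\sigma}(\Omega)$, $$\big|\big(\boldsymbol v\cdot\nabla\boldsymbol v,\bar{\boldsymbol u}\big)\big|\le\delta\,\|\nabla\boldsymbol v\|_2^2 .$$
   Context: Domain: $\Omega=\mathbb{R}^2\setminus\bar B$, where $B$ is a bounded simply connected Lipschitz domain with $\boldsymbol 0\in B$. $\dot H^1_{0,\sigma}(\Omega)$ is the completion, in the natural norm of $\dot H^1(\Omega)$, of the space $C^\infty_{0,\sigma}(\Omega)$ of smooth divergence-free vector fields with compact support in $\Omega$. A field $\boldsymbol v\in\dot H^1_{0,\sigma}(\Omega)$ is centrally symmetric if $\boldsymbol v(\boldsymbol x)=-\boldsymbol v(-\boldsymbol x)$, where $\boldsymbol v$ is extended by zero to $\mathbb{R}^2$. $(\cdot,\cdot)$ is the $L^2(\Omega)$ pairing, so $(\boldsymbol v\cdot\nabla\boldsymbol v,\bar{\boldsymbol u})=\int_\Omega\sum_{i,j}v_i(\partial_iv_j)\bar u_j$, and $\|\cdot\|_2$ is the $L^2(\Omega)$ norm. *)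

theory Defs
  imports "HOL-Analysis.Analysis"
begin

type_synonym plane = "real^2"

text \<open>Near each boundary point the set is, in suitable orthonormal coordinates, the strict
  epigraph of a Lipschitz function.\<close>

definition lipschitz_boundary :: "plane set \<Rightarrow> bool" where
  "lipschitz_boundary B \<longleftrightarrow>
     (\<forall>p\<in>frontier B. \<exists>r>0. \<exists>Q :: plane \<Rightarrow> plane. \<exists>\<gamma> :: real \<Rightarrow> real. \<exists>L.
        orthogonal_transformation Q \<and> L-lipschitz_on UNIV \<gamma> \<and>
        B \<inter> ball p r = {x \<in> ball p r. Q (x - p) $ 2 > \<gamma> (Q (x - p) $ 1)})"

definition admissible_obstacle :: "plane set \<Rightarrow> bool" where
  "admissible_obstacle B \<longleftrightarrow>
     open B \<and> bounded B \<and> simply_connected B \<and> lipschitz_boundary B \<and> 0 \<in> B"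

definition exterior_domain :: "plane set \<Rightarrow> plane set" where
  "exterior_domain B = - closure B"

definition partial_deriv :: "2 \<Rightarrow> (plane \<Rightarrow> 'b::real_normed_vector) \<Rightarrow> plane \<Rightarrow> 'b" where
  "partial_deriv i f x = frechet_derivative f (at x) (axis i 1)"

primrec Ck :: "nat \<Rightarrow> (plane \<Rightarrow> 'b::real_normed_vector) \<Rightarrow> bool" where
  "Ck 0 f \<longleftrightarrow> continuous_on UNIV f"
| "Ck (Suc k) f \<longleftrightarrow> (\<forall>x. f differentiable (at x)) \<and> (\<forall>i. Ck k (partial_deriv i f))"

text \<open>Compactly supported functions on an open set \<open>\<Omega>\<close> are identified with their (smooth)
  extension by zero to the whole plane.\<close>

definition smooth_compact_support :: "plane set \<Rightarrow> (plane \<Rightarrow> 'b::real_normed_vector) set" where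
  "smooth_compact_support \<Omega> =
     {f. (\<forall>k. Ck k f) \<and> compact (closure {x. f x \<noteq> 0}) \<and> closure {x. f x \<noteq> 0} \<subseteq> \<Omega>}"

definition divergence :: "(plane \<Rightarrow> plane) \<Rightarrow> plane \<Rightarrow> real" where
  "divergence f x = (\<Sum>i\<in>UNIV. partial_deriv i f x $ i)"

definition smooth_solenoidal :: "plane set \<Rightarrow> (plane \<Rightarrow> plane) set" where
  "smooth_solenoidal \<Omega> = {\<phi> \<in> smooth_compact_support \<Omega>. \<forall>x. divergence \<phi> x = 0}"

definition L2 :: "plane set \<Rightarrow> (plane \<Rightarrow> 'b::euclidean_space) set" where
  "L2 S = {f. f \<in> borel_measurable (lebesgue_on S) \<and> integrable (lebesgue_on S) (\<lambda>x. (norm (f x))\<^sup>2)}"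

definition L2_norm :: "plane set \<Rightarrow> (plane \<Rightarrow> 'b::euclidean_space) \<Rightarrow> real" where
  "L2_norm S f = sqrt (LINT x|lebesgue_on S. (norm (f x))\<^sup>2)"

definition L2_tendsto ::
  "plane set \<Rightarrow> (nat \<Rightarrow> plane \<Rightarrow> 'b::euclidean_space) \<Rightarrow> (plane \<Rightarrow> 'b) \<Rightarrow> bool" where
  "L2_tendsto S f g \<longleftrightarrow>
     (\<forall>n. (\<lambda>x. f n x - g x) \<in> L2 S) \<and> (\<lambda>n. L2_norm S (\<lambda>x. f n x - g x)) \<longlonglongrightarrow> 0"

text \<open>Gradients follow the convention of \<^const>\<open>jacobian\<close>: row \<open>j\<close>, column \<open>i\<close> holds
  \<open>\<partial>\<^sub>i v\<^sub>j\<close>. The norm of \<^typ>\<open>real^2^2\<close> is the Frobenius norm.\<close>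

definition locally_integrable :: "plane set \<Rightarrow> (plane \<Rightarrow> 'b::euclidean_space) \<Rightarrow> bool" where
  "locally_integrable \<Omega> f \<longleftrightarrow> (\<forall>K. compact K \<and> K \<subseteq> \<Omega> \<longrightarrow> integrable (lebesgue_on K) f)"

definition has_weak_gradient ::
  "plane set \<Rightarrow> (plane \<Rightarrow> plane) \<Rightarrow> (plane \<Rightarrow> real^2^2) \<Rightarrow> bool" where
  "has_weak_gradient \<Omega> v Dv \<longleftrightarrow>
     locally_integrable \<Omega> v \<and> locally_integrable \<Omega> Dv \<and>
     (\<forall>\<psi> \<in> smooth_compact_support \<Omega>. \<forall>i j.
        (LINT x|lebesgue_on \<Omega>. v x $ j * partial_deriv i \<psi> x)
          = - (LINT x|lebesgue_on \<Omega>. Dv x $ j $ i * \<psi> x))"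

text \<open>The completion of \<^const>\<open>smooth_solenoidal\<close> in the norm \<open>\<phi> \<mapsto> \<parallel>\<nabla>\<phi>\<parallel>\<^sub>2\<close>, realised as a space of
  functions: on an exterior domain whose complement has interior points, a sequence of test
  fields that is Cauchy in this norm also converges in \<open>L\<^sup>2\<close> on every bounded part of \<open>\<Omega>\<close>, by a
  Poincare inequality, and an element of the completion is identified with that limit, whose weak
  gradient is the \<open>L\<^sup>2\<close> limit of the gradients. Only the values on \<open>\<Omega>\<close> are relevant.\<close>

definition H1_dot_0_sigma :: "plane set \<Rightarrow> (plane \<Rightarrow> plane) set" where
  "H1_dot_0_sigma \<Omega> =
     {v. \<exists>Dv \<phi>. has_weak_gradient \<Omega> v Dv \<and>
          (\<forall>n. \<phi> n \<in> smooth_solenoidal \<Omega>) \<and>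
          (\<forall>R>0. L2_tendsto (\<Omega> \<inter> ball 0 R) \<phi> v) \<and>
          L2_tendsto \<Omega> (\<lambda>n x. jacobian (\<phi> n) (at x)) Dv}"

definition zero_extension :: "plane set \<Rightarrow> (plane \<Rightarrow> plane) \<Rightarrow> plane \<Rightarrow> plane" where
  "zero_extension \<Omega> v x = (if x \<in> \<Omega> then v x else 0)"

definition centrally_symmetric :: "plane set \<Rightarrow> (plane \<Rightarrow> plane) \<Rightarrow> bool" where
  "centrally_symmetric \<Omega> v \<longleftrightarrow>
     (AE x in lebesgue. zero_extension \<Omega> v x = - zero_extension \<Omega> v (- x))"

text \<open>The integrand of \<open>(v \<cdot> \<nabla>v, u)\<close>, where \<open>Dv\<close> is the gradient of \<open>v\<close>.\<close>

definition convection_integrand ::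
  "(plane \<Rightarrow> plane) \<Rightarrow> (plane \<Rightarrow> real^2^2) \<Rightarrow> (plane \<Rightarrow> plane) \<Rightarrow> plane \<Rightarrow> real" where
  "convection_integrand v Dv u x = (\<Sum>i\<in>UNIV. \<Sum>j\<in>UNIV. v x $ i * Dv x $ j $ i * u x $ j)"

end

theory Submission
  imports Defs
begin

text \<open>A centrally symmetric field satisfies the Hardy inequality
  \<open>\<parallel>v / |x|\<parallel>\<^sub>2 \<le> c \<parallel>\<nabla>v\<parallel>\<^sub>2\<close>, which fails for general fields in the plane; together with
  \<open>|x| |u| \<le> \<delta> / C\<close> it bounds the trilinear form. To prove it without polar coordinates, join \<open>x\<close>
  to \<open>- x\<close> by the half circle \<open>t \<mapsto> rot t x\<close>: for a test field \<open>\<phi>\<close>, integrating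
  \<open>|\<phi>(x) - \<phi>(- x)|\<^sup>2 / |x|\<^sup>2 \<le> \<pi> \<integral>\<^sub>0\<^sup>\<pi> |\<nabla>\<phi>(rot t x)|\<^sup>2 dt\<close> over \<open>x\<close> and using that rotations
  preserve Lebesgue measure gives a bound by \<open>\<pi>\<^sup>2 \<parallel>\<nabla>\<phi>\<parallel>\<^sub>2\<^sup>2\<close>. The test fields approximating \<open>v\<close>
  need not be symmetric: only in the limit (Fatou) does \<open>\<phi>(x) - \<phi>(- x)\<close> become \<open>2 v(x)\<close>.
  As the limit of the gradients is a weak gradient, it agrees almost everywhere with the given one.\<close>

section \<open>Almost everywhere uniqueness of weak gradients\<close>

definition flat :: "real poly \<Rightarrow> real \<Rightarrow> real" where
  "flat p t = (if t > 0 then poly p (1 / t) * exp (- (1 / t)) else 0)"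

text \<open>With s = 1/t one has d/dt = - s^2 d/ds, so p(s) exp(-s) has the t-derivative s^2 (p(s) -
  p'(s)) exp(-s). Taking a polynomial in 1/t as parameter thus gives a family closed under
  differentiation, and smoothness follows by induction.\<close>

definition flat_deriv :: "real poly \<Rightarrow> real poly" where
  "flat_deriv p = [:0, 0, 1:] * (p - pderiv p)"

lemma poly_exp_neg_tendsto_0: "((\<lambda>s::real. poly p s * exp (- s)) \<longlongrightarrow> 0) at_top"
proof (induction p)
  case 0
  then show ?case by simp
next
  case (pCons a p)
  have pw: "((\<lambda>s::real. s ^ k * exp (- s)) \<longlongrightarrow> 0) at_top" for k
    using tendsto_power_div_exp_0[of k] by (simp add: exp_minus divide_inverse)
  have "((\<lambda>s::real. \<Sum>i\<le>degree (pCons a p). coeff (pCons a p) i * (s ^ i * exp (- s)))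
         \<longlongrightarrow> (\<Sum>i\<le>degree (pCons a p). coeff (pCons a p) i * 0)) at_top"
    by (intro tendsto_intros pw)
  then show ?case
    by (simp add: poly_altdef sum_distrib_right mult.assoc del: poly_pCons)
qed

text \<open>Away from 0 this is the calculation behind \<open>flat_deriv\<close>. At 0 the
  difference quotient vanishes on the left and tends to 0 on the right, because exp(-1/h) decays
  faster than any power of h.\<close>

lemma flat_has_derivative: "(flat p has_real_derivative flat (flat_deriv p) t) (at t)"
proof -
  consider "t > 0" | "t < 0" | "t = 0" by linarith
  then show ?thesis
  proof cases
    case 1
    have "((\<lambda>t. poly p (1 / t) * exp (- (1 / t))) has_real_derivative flat (flat_deriv p) t) (at t)"
      using 1 by (auto intro!: derivative_eq_intros poly_DERIV[THEN DERIV_chain2]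
          simp: flat_def flat_deriv_def field_simps power2_eq_square)
    moreover have "\<forall>\<^sub>F s in nhds t. flat p s = poly p (1 / s) * exp (- (1 / s))"
      using eventually_nhds_in_open[of "{0<..}" t] 1 by (auto simp: flat_def elim!: eventually_mono)
    ultimately show ?thesis
      by (subst DERIV_cong_ev[OF refl _ refl])
  next
    case 2
    have "\<forall>\<^sub>F s in nhds t. flat p s = 0"
      using eventually_nhds_in_open[of "{..<0}" t] 2 by (auto simp: flat_def elim!: eventually_mono)
    moreover have "((\<lambda>t. 0) has_real_derivative flat (flat_deriv p) t) (at t)"
      using 2 by (simp add: flat_def)
    ultimately show ?thesis
      by (subst DERIV_cong_ev[OF refl _ refl])
  next
    case 3
    \<comment> \<open>Dividing by h multiplies the polynomial in 1/h by its variable, whence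
      \<open>pCons 0 p\<close>.\<close>
    have "((\<lambda>h. poly (pCons 0 p) (inverse h) * exp (- inverse h)) \<longlongrightarrow> 0) (at_right 0)"
      by (rule filterlim_compose[OF poly_exp_neg_tendsto_0 filterlim_inverse_at_top_right])
    then have "((\<lambda>h. flat p h / h) \<longlongrightarrow> 0) (at_right 0)"
      by (rule Lim_transform_eventually)
        (auto simp: eventually_at_filter flat_def field_simps)
    moreover have "((\<lambda>h. flat p h / h) \<longlongrightarrow> 0) (at_left 0)"
      by (rule Lim_transform_eventually[OF tendsto_const])
        (auto simp: eventually_at_filter flat_def)
    ultimately have "((\<lambda>h. flat p h / h) \<longlongrightarrow> 0) (at 0)"
      by (simp add: filterlim_at_split)
    then show ?thesis
      using 3 by (simp add: DERIV_def flat_def)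
  qed
qed

section \<open>Closure properties of the classes \<open>Ck\<close>\<close>

lemma partial_deriv_eq: "(f has_derivative f') (at x) \<Longrightarrow> partial_deriv i f x = f' (axis i 1)"
  unfolding partial_deriv_def by (metis frechet_derivative_at)

text \<open>The recursion in \<open>Ck\<close> asks for continuity at level 0 only; at the levels
  above, differentiability supplies it. The product rule relies on this nesting, since it leaves one
  factor undifferentiated.\<close>

lemma Ck_Suc_imp_Ck: "Ck (Suc k) f \<Longrightarrow> Ck k f"
proof (induction k arbitrary: f)
  case 0
  then show ?case
    by (simp add: continuous_at_imp_continuous_on differentiable_imp_continuous_within)
next
  case (Suc k)
  have "Ck k (partial_deriv i f)" for i
    using Suc.IH Suc.prems by simp
  then show ?case using Suc.prems by simp
qed

lemma Ck_const: "Ck k (\<lambda>x. c)"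
proof (induction k arbitrary: c)
  case 0
  then show ?case by simp
next
  case (Suc k)
  have "partial_deriv i (\<lambda>x. c) = (\<lambda>x. 0)" for i
    by (rule ext) (simp add: partial_deriv_def)
  then show ?case using Suc by simp
qed

lemma Ck_add:
  assumes "Ck k f" "Ck k g"
  shows "Ck k (\<lambda>x. f x + g x)"
  using assms
proof (induction k arbitrary: f g)
  case 0
  then show ?case by (simp add: continuous_on_add)
next
  case (Suc k)
  have "partial_deriv i (\<lambda>x. f x + g x) = (\<lambda>x. partial_deriv i f x + partial_deriv i g x)" for i
  proof
    fix x
    show "partial_deriv i (\<lambda>x. f x + g x) x = partial_deriv i f x + partial_deriv i g x"
      unfolding partial_deriv_def[of i f] partial_deriv_def[of i g]
      using Suc.prems by (intro partial_deriv_eq has_derivative_add) (auto simp: frechet_derivative_works)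
  qed
  then show ?case using Suc by simp
qed

lemma Ck_mult:
  fixes f g :: "plane \<Rightarrow> real"
  assumes "Ck k f" "Ck k g"
  shows "Ck k (\<lambda>x. f x * g x)"
  using assms
proof (induction k arbitrary: f g)
  case 0
  then show ?case by (simp add: continuous_on_mult)
next
  case (Suc k)
  have "partial_deriv i (\<lambda>x. f x * g x) = (\<lambda>x. f x * partial_deriv i g x + partial_deriv i f x * g x)" for i
  proof
    fix x
    show "partial_deriv i (\<lambda>x. f x * g x) x = f x * partial_deriv i g x + partial_deriv i f x * g x"
      unfolding partial_deriv_def[of i f] partial_deriv_def[of i g]
      using Suc.prems
      by (intro partial_deriv_eq[where f' = "\<lambda>h. f x * frechet_derivative g (at x) h + frechet_derivative f (at x) h * g x" for x]
          has_derivative_mult) (auto simp: frechet_derivative_works)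
  qed
  moreover have "Ck k f" "Ck k g"
    using Suc.prems by (blast intro: Ck_Suc_imp_Ck)+
  ultimately show ?case using Suc by (simp add: Ck_add)
qed

text \<open>The induction keeps \<open>p\<close> arbitrary, as a partial derivative replaces it by
  \<open>flat_deriv p\<close>, up to a constant factor. The affine argument serves both of two
  opposite faces of a box.\<close>

lemma Ck_flat: "Ck k (\<lambda>x. flat p (c * x $ j + d))"
proof (induction k arbitrary: p)
  have der: "((\<lambda>x::plane. flat p (c * x $ j + d)) has_derivative
      (\<lambda>h. flat (flat_deriv p) (c * x $ j + d) * (c * h $ j))) (at x)" for p x
  proof -
    have "((\<lambda>x::plane. c * x $ j + d) has_derivative (\<lambda>h. c * h $ j)) (at x)"
      by (auto intro!: derivative_eq_intros bounded_linear.has_derivative[OF bounded_linear_vec_nth])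
    from has_derivative_compose[OF this flat_has_derivative[of p "c * x $ j + d", unfolded has_field_derivative_def]]
    show ?thesis by simp
  qed
  case 0
  show ?case
    by (simp, intro continuous_at_imp_continuous_on ballI differentiable_imp_continuous_within)
      (use der differentiable_def in blast)
  case (Suc k)
  have "partial_deriv i (\<lambda>x. flat p (c * x $ j + d)) =
      (\<lambda>x. flat (flat_deriv p) (c * x $ j + d) * (c * axis i 1 $ j))" for i
    by (rule ext) (rule partial_deriv_eq[OF der])
  then show ?case
    using Suc der by (fastforce intro: Ck_mult Ck_const simp: differentiable_def)
qed



text \<open>As \<open>n \<rightarrow> \<infinity>\<close> these test functions increase to the indicator of \<open>box a b\<close>, because
  \<open>exp (- 1 / (n s)) \<rightarrow> 1\<close> for \<open>s > 0\<close>.\<close>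

definition box_bump :: "plane \<Rightarrow> plane \<Rightarrow> nat \<Rightarrow> plane \<Rightarrow> real" where
  "box_bump a b n x =
     (\<Prod>j\<in>UNIV. flat 1 (real n * (x $ j - a $ j)) * flat 1 (real n * (b $ j - x $ j)))"

lemma flat_1_bounds: "0 \<le> flat 1 t" "flat 1 t \<le> 1"
  by (auto simp: flat_def)

lemma flat_1_scaled_tendsto_1:
  assumes "s > 0"
  shows "(\<lambda>n. flat 1 (real n * s)) \<longlonglongrightarrow> 1"
proof -
  have "(\<lambda>n. exp (- (1 / s) * (1 / real n))) \<longlonglongrightarrow> exp (- (1 / s) * 0)"
    by (intro tendsto_intros lim_1_over_n)
  then have "(\<lambda>n. exp (- (1 / s) * (1 / real n))) \<longlonglongrightarrow> 1"
    by simp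
  then show ?thesis
    by (rule Lim_transform_eventually)
      (auto intro!: eventually_mono[OF eventually_gt_at_top[of 0]] simp: flat_def assms field_simps)
qed

lemma box_bump_bounds: "0 \<le> box_bump a b n x" "box_bump a b n x \<le> 1"
  unfolding box_bump_def
  by (intro prod_nonneg prod_le_1 conjI mult_nonneg_nonneg mult_le_one flat_1_bounds ballI)+

lemma box_bump_outside:
  assumes "x \<notin> box a b"
  shows "box_bump a b n x = 0"
proof -
  obtain j where "x $ j - a $ j \<le> 0 \<or> b $ j - x $ j \<le> 0"
    using assms by (auto simp: mem_box_cart not_less)
  \<comment> \<open>\<open>flat\<close> vanishes at every argument that is not positive, so n = 0,
    where all arguments are 0, needs no separate treatment.\<close>
  then have "\<not> 0 < real n * (x $ j - a $ j) \<or> \<not> 0 < real n * (b $ j - x $ j)"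
    by (auto simp: zero_less_mult_iff)
  then have "flat 1 (real n * (x $ j - a $ j)) * flat 1 (real n * (b $ j - x $ j)) = 0"
    by (auto simp only: flat_def if_False mult_zero_left mult_zero_right)
  then show ?thesis
    unfolding box_bump_def by (intro prod_zero) auto
qed

lemma box_bump_tendsto: "(\<lambda>n. box_bump a b n x) \<longlonglongrightarrow> indicator (box a b) x"
proof (cases "x \<in> box a b")
  case True
  then have "(\<lambda>n. box_bump a b n x) \<longlonglongrightarrow> (\<Prod>j\<in>(UNIV :: 2 set). 1 * 1)"
    unfolding box_bump_def
    by (intro tendsto_prod tendsto_mult flat_1_scaled_tendsto_1) (auto simp: mem_box_cart)
  with True show ?thesis by simp
next
  case False
  then show ?thesis by (simp add: box_bump_outside)
qed

lemma box_bump_smooth_compact_support: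
  assumes "cbox a b \<subseteq> \<Omega>"
  shows "box_bump a b n \<in> smooth_compact_support \<Omega>"
proof -
  have 1: "Ck k (\<lambda>x. flat 1 (real n * (x $ j - a $ j)))" for k j
    using Ck_flat[of k 1 "real n" j "- real n * a $ j"] by (simp add: algebra_simps)
  have 2: "Ck k (\<lambda>x. flat 1 (real n * (b $ j - x $ j)))" for k j
    using Ck_flat[of k 1 "- real n" j "real n * b $ j"] by (simp add: algebra_simps)
  have "Ck k (box_bump a b n)" for k
    unfolding box_bump_def[abs_def] UNIV_2 by (simp add: Ck_mult 1 2)
  moreover have cl: "closure {x. box_bump a b n x \<noteq> 0} \<subseteq> cbox a b"
    using box_bump_outside[of _ a b n] box_subset_cbox[of a b]
    by (intro closure_minimal) auto
  moreover have "compact (closure {x. box_bump a b n x \<noteq> 0})"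
    using cl by (meson bounded_cbox bounded_subset closed_closure compact_eq_bounded_closed)
  ultimately show ?thesis
    using assms unfolding smooth_compact_support_def by blast
qed

text \<open>As \<open>g\<close> is integrable only on compact subsets, the limit is taken over the
  box, outside which the bumps are 0. There the norm of \<open>g\<close> dominates, because the
  bumps lie between 0 and 1.\<close>

lemma integral_box_bump_tendsto:
  fixes g :: "plane \<Rightarrow> real"
  assumes g: "locally_integrable \<Omega> g" and ab: "cbox a b \<subseteq> \<Omega>" and \<Omega>: "open \<Omega>"
  shows "(\<lambda>n. LINT x|lebesgue_on \<Omega>. g x * box_bump a b n x)
           \<longlonglongrightarrow> (LINT x|lebesgue_on (cbox a b). g x)"
proof -
  let ?M = "lebesgue_on (cbox a b)"
  have gi: "integrable ?M g"
    using g ab unfolding locally_integrable_def by (simp add: compact_cbox)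
  have bm: "box_bump a b n \<in> borel_measurable ?M" for n
  proof -
    have "Ck 0 (box_bump a b n)"
      using box_bump_smooth_compact_support[of a b UNIV n] unfolding smooth_compact_support_def by blast
    then have "continuous_on (cbox a b) (box_bump a b n)"
      by (auto intro: continuous_on_subset)
    then show ?thesis
      by (rule continuous_imp_measurable_on_sets_lebesgue) auto
  qed
  \<comment> \<open>The bumps converge to the indicator of the open box, while the limit integral is
    over the closed one.\<close>
  have null: "AE x in ?M. x \<in> box a b"
    using negligible_frontier_interval[of a b]
    by (auto simp: AE_restrict_space_iff negligible_iff_null_sets intro!: AE_I'[of "cbox a b - box a b"])
  have "(\<lambda>n. LINT x|?M. g x * box_bump a b n x) \<longlonglongrightarrow> (LINT x|?M. g x)"
  proof (rule integral_dominated_convergence)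
    show "AE x in ?M. (\<lambda>n. g x * box_bump a b n x) \<longlonglongrightarrow> g x"
      using null
    proof eventually_elim
      case (elim x)
      then show ?case
        using tendsto_mult[OF tendsto_const[of "g x"] box_bump_tendsto[of a b x]] by simp
    qed
    show "AE x in ?M. norm (g x * box_bump a b n x) \<le> norm (g x)" for n
      using box_bump_bounds[of a b n]
      by (auto simp: abs_mult mult_left_le)
    show "integrable ?M (\<lambda>x. norm (g x))"
      using gi by simp
    show "(\<lambda>x. g x * box_bump a b n x) \<in> borel_measurable ?M" for n
      using gi bm by measurable
  qed (use gi in auto)
  moreover have "(LINT x|lebesgue_on \<Omega>. g x * box_bump a b n x) = (LINT x|?M. g x * box_bump a b n x)" for n
  proof -
    have "indicator \<Omega> x *\<^sub>R (g x * box_bump a b n x) = indicator (cbox a b) x *\<^sub>R (g x * box_bump a b n x)" for x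
      using ab box_bump_outside[of x a b n] box_subset_cbox[of a b] by (auto simp: indicator_def)
    moreover have "\<Omega> \<inter> space lebesgue \<in> sets lebesgue" "cbox a b \<inter> space lebesgue \<in> sets lebesgue"
      using \<Omega> by auto
    ultimately show ?thesis
      by (simp only: integral_restrict_space)
  qed
  ultimately show ?thesis by simp
qed

section \<open>From integrals over boxes to equality almost everywhere\<close>

lemma open_eq_Union_countable_cboxes:
  fixes \<Omega> :: "'a::euclidean_space set"
  assumes "open \<Omega>"
  shows "\<exists>\<D>. countable \<D> \<and> \<D> \<subseteq> Pow \<Omega> \<and> (\<forall>X\<in>\<D>. \<exists>a b. X = cbox a b) \<and> \<Union>\<D> = \<Omega>"
proof (rule open_countable_Union_open_cbox[OF assms])
  fix \<D> assume "countable \<D>" "\<D> \<subseteq> Pow \<Omega>" "\<And>X. X \<in> \<D> \<Longrightarrow> \<exists>a b. X = cbox a b" "\<Union>\<D> = \<Omega>"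
  then show ?thesis
    by (intro exI[of _ \<D>]) simp
qed

text \<open>Local integrability gives measurability on each compact box, and countably many boxes
  cover the open set.\<close>

lemma locally_integrable_measurable:
  assumes f: "locally_integrable \<Omega> f" and \<Omega>: "open \<Omega>"
  shows "f \<in> borel_measurable (lebesgue_on \<Omega>)"
proof -
  from open_eq_Union_countable_cboxes[OF \<Omega>]
  obtain \<D> where "countable \<D> \<and> \<D> \<subseteq> Pow \<Omega> \<and> (\<forall>X\<in>\<D>. \<exists>a b. X = cbox a b) \<and> \<Union>\<D> = \<Omega>" ..
  then have \<D>: "countable \<D>" "\<D> \<subseteq> Pow \<Omega>" "\<forall>X\<in>\<D>. \<exists>a b. X = cbox a b" "\<Union>\<D> = \<Omega>"
    by simp_all
  show ?thesis
  proof (rule measurable_piecewise_restrict[OF \<D>(1)])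
    fix X assume X: "X \<in> \<D>"
    from bspec[OF \<D>(3) X] obtain a b where ab: "X = cbox a b" by (elim exE)
    have sub: "\<Omega> \<inter> X = X" using X \<D>(2) by blast
    show "X \<inter> space (lebesgue_on \<Omega>) \<in> sets (lebesgue_on \<Omega>)"
      using sub \<Omega> unfolding ab sets_restrict_space space_restrict_space
      by (intro image_eqI[of _ _ "cbox a b"]) auto
    have "X \<subseteq> \<Omega>"
      using X \<D>(2) by blast
    then have "integrable (lebesgue_on X) f"
      using f unfolding locally_integrable_def ab by (simp add: compact_cbox)
    then have "f \<in> borel_measurable (lebesgue_on X)"
      by (rule borel_measurable_integrable)
    then show "f \<in> borel_measurable (restrict_space (lebesgue_on \<Omega>) X)"
      using restrict_restrict_space[of \<Omega> lebesgue X] \<Omega> ab sub by simp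
  qed (use \<D>(4) in auto)
qed

text \<open>By Lebesgue differentiation: on a box inside \<open>\<Omega>\<close> the difference has
  mean 0 over all small cubes, hence is 0 almost everywhere. Countably many boxes exhaust
  \<open>\<Omega>\<close>.\<close>

lemma AE_eq_if_box_integrals_eq:
  fixes f g :: "plane \<Rightarrow> real"
  assumes f: "locally_integrable \<Omega> f" and g: "locally_integrable \<Omega> g" and \<Omega>: "open \<Omega>"
    and eq: "\<And>a b. cbox a b \<subseteq> \<Omega> \<Longrightarrow>
      (LINT x|lebesgue_on (cbox a b). f x) = (LINT x|lebesgue_on (cbox a b). g x)"
  shows "AE x in lebesgue_on \<Omega>. f x = g x"
proof -
  have box: "AE x in lebesgue. x \<in> cbox a b \<longrightarrow> f x = g x" if ab: "cbox a b \<subseteq> \<Omega>" for a b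
  proof -
    \<comment> \<open>Cutting off outside the box makes every integral of \<open>h\<close> over
      \<open>cbox c d\<close> one over the intersection of two boxes, which is again a box inside
      \<open>\<Omega>\<close>, so that \<open>eq\<close> applies.\<close>
    define h where "h = (\<lambda>x. if x \<in> cbox a b then f x - g x else 0)"
    have h: "h integrable_on cbox c d \<and> integral (cbox c d) h = 0" for c d
    proof -
      obtain u v where uv: "cbox c d \<inter> cbox a b = cbox u v"
        using Int_interval[of c d a b] by blast
      have sub: "cbox u v \<subseteq> \<Omega>" using uv ab by blast
      have fi: "integrable (lebesgue_on (cbox u v)) f" and gi: "integrable (lebesgue_on (cbox u v)) g"
        using f g sub unfolding locally_integrable_def by (auto simp: compact_cbox)
      have "integrable (lebesgue_on (cbox u v)) (\<lambda>x. f x - g x)"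
        using fi gi by simp
      then have "(\<lambda>x. f x - g x) integrable_on cbox u v"
        and "integral (cbox u v) (\<lambda>x. f x - g x) = (LINT x|lebesgue_on (cbox u v). f x - g x)"
        by (simp_all add: lebesgue_integral_eq_integral integrable_on_lebesgue_on)
      moreover have "(LINT x|lebesgue_on (cbox u v). f x - g x) = 0"
        using fi gi eq[OF sub] by simp
      ultimately show ?thesis
        unfolding h_def by (simp add: integrable_restrict_Int integral_restrict_Int uv Int_commute[of "cbox a b"])
    qed
    \<comment> \<open>Outside a negligible set, \<open>h x\<close> is the limit of the averages of
      \<open>h\<close> over cubes with lower corner \<open>x\<close>. These averages are all 0, so
      taking the norm of \<open>h x\<close> as tolerance refutes that \<open>h x\<close> is
      nonzero.\<close>
    obtain N where N: "negligible N"
      "\<And>x e. \<lbrakk>x \<notin> N; 0 < e\<rbrakk> \<Longrightarrow>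
         \<exists>d>0. \<forall>r. 0 < r \<and> r < d \<longrightarrow>
           norm (integral (cbox x (x + r *\<^sub>R One)) h /\<^sub>R r ^ DIM(plane) - h x) < e"
      by (rule integrable_ccontinuous_explicit[of h]) (use h in blast)+
    have "h x = 0" if "x \<notin> N" for x
    proof (rule ccontr)
      assume "h x \<noteq> 0"
      then obtain d where "d > 0" "\<forall>r. 0 < r \<and> r < d \<longrightarrow>
           norm (integral (cbox x (x + r *\<^sub>R One)) h /\<^sub>R r ^ DIM(plane) - h x) < norm (h x)"
        using N(2)[OF \<open>x \<notin> N\<close>, of "norm (h x)"] by auto
      then have "norm (integral (cbox x (x + (d / 2) *\<^sub>R One)) h /\<^sub>R (d / 2) ^ DIM(plane) - h x) < norm (h x)"
        by (metis half_gt_zero field_sum_of_halves less_add_same_cancel1)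
      then show False
        using h[of x "x + (d / 2) *\<^sub>R One"] by simp
    qed
    then show ?thesis
      using N(1) unfolding h_def negligible_iff_null_sets
      by (intro AE_I'[of N]) force+
  qed
  from open_eq_Union_countable_cboxes[OF \<Omega>]
  obtain \<D> where "countable \<D> \<and> \<D> \<subseteq> Pow \<Omega> \<and> (\<forall>X\<in>\<D>. \<exists>a b. X = cbox a b) \<and> \<Union>\<D> = \<Omega>" ..
  then have \<D>: "countable \<D>" "\<D> \<subseteq> Pow \<Omega>" "\<forall>X\<in>\<D>. \<exists>a b. X = cbox a b" "\<Union>\<D> = \<Omega>"
    by simp_all
  have "AE x in lebesgue. \<forall>X\<in>\<D>. x \<in> X \<longrightarrow> f x = g x"
  proof (subst AE_ball_countable[OF \<D>(1)], intro ballI)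
    fix X assume X: "X \<in> \<D>"
    from bspec[OF \<D>(3) X] obtain a b where "X = cbox a b" by (elim exE)
    moreover have "X \<subseteq> \<Omega>" using X \<D>(2) by blast
    ultimately show "AE x in lebesgue. x \<in> X \<longrightarrow> f x = g x"
      using box by simp
  qed
  then have "AE x in lebesgue. x \<in> \<Omega> \<longrightarrow> f x = g x"
    by eventually_elim (use \<D>(4) in blast)
  then show ?thesis
    using \<Omega> by (simp add: AE_restrict_space_iff)
qed

lemma locally_integrable_entry:
  fixes D :: "plane \<Rightarrow> real^2^2"
  assumes "locally_integrable \<Omega> D"
  shows "locally_integrable \<Omega> (\<lambda>x. D x $ j $ i)"
  unfolding locally_integrable_def
proof (intro allI impI)
  fix K assume "compact K \<and> K \<subseteq> \<Omega>"
  then have "integrable (lebesgue_on K) D"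
    using assms unfolding locally_integrable_def by blast
  then show "integrable (lebesgue_on K) (\<lambda>x. D x $ j $ i)"
    by (intro integrable_bounded_linear[OF bounded_linear_vec_nth])
qed

text \<open>Testing with the bumps of a box and letting n grow shows that the entries of both
  gradients have the same integral over every box inside \<open>\<Omega>\<close>.\<close>

lemma weak_gradient_unique:
  assumes "has_weak_gradient \<Omega> v D" "has_weak_gradient \<Omega> v E" and \<Omega>: "open \<Omega>"
  shows "AE x in lebesgue_on \<Omega>. D x = E x"
proof -
  have li: "locally_integrable \<Omega> (\<lambda>x. D x $ j $ i)" "locally_integrable \<Omega> (\<lambda>x. E x $ j $ i)" for i j
    using assms unfolding has_weak_gradient_def by (auto intro: locally_integrable_entry)
  have "AE x in lebesgue_on \<Omega>. D x $ j $ i = E x $ j $ i" for i j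
  proof (rule AE_eq_if_box_integrals_eq[OF li \<Omega>])
    fix a b assume ab: "cbox a b \<subseteq> \<Omega>"
    have "(LINT x|lebesgue_on \<Omega>. D x $ j $ i * box_bump a b n x) =
        (LINT x|lebesgue_on \<Omega>. E x $ j $ i * box_bump a b n x)" for n
    proof -
      have "(LINT x|lebesgue_on \<Omega>. v x $ j * partial_deriv i (box_bump a b n) x)
              = - (LINT x|lebesgue_on \<Omega>. D x $ j $ i * box_bump a b n x)"
        "(LINT x|lebesgue_on \<Omega>. v x $ j * partial_deriv i (box_bump a b n) x)
              = - (LINT x|lebesgue_on \<Omega>. E x $ j $ i * box_bump a b n x)"
        using assms box_bump_smooth_compact_support[OF ab, of n]
        unfolding has_weak_gradient_def by blast+
      then show ?thesis by linarith
    qed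
    then show "(LINT x|lebesgue_on (cbox a b). D x $ j $ i) = (LINT x|lebesgue_on (cbox a b). E x $ j $ i)"
      using integral_box_bump_tendsto[OF li(1)[of j i] ab \<Omega>] integral_box_bump_tendsto[OF li(2)[of j i] ab \<Omega>]
      by (simp only: LIMSEQ_unique)
  qed
  then have "AE x in lebesgue_on \<Omega>. \<forall>j i. D x $ j $ i = E x $ j $ i"
    by (simp add: AE_all_countable)
  then show ?thesis
    by eventually_elim (simp add: vec_eq_iff)
qed

section \<open>A Hardy inequality for antipodal differences\<close>

definition rot :: "real \<Rightarrow> plane \<Rightarrow> plane" where
  "rot t x = (\<chi> j. cos t * x $ j + sin t * (if j = 1 then - (x $ 2) else x $ 1))"

lemma rot_nth: "rot t x $ 1 = cos t * x $ 1 - sin t * x $ 2" "rot t x $ 2 = cos t * x $ 2 + sin t * x $ 1"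
  by (simp_all add: rot_def)

lemma linear_rot: "linear (rot t)"
  by (rule linearI) (simp_all add: vec_eq_iff rot_def algebra_simps)

lemma norm_rot [simp]: "norm (rot t x) = norm x"
proof -
  have "(c * a - s * b)\<^sup>2 + (c * b + s * a)\<^sup>2 = (c\<^sup>2 + s\<^sup>2) * (a\<^sup>2 + b\<^sup>2)" for a b c s :: real
    by algebra
  then have "(rot t x $ 1)\<^sup>2 + (rot t x $ 2)\<^sup>2 = (x $ 1)\<^sup>2 + (x $ 2)\<^sup>2"
    by (simp add: rot_nth)
  then show ?thesis
    by (simp add: norm_vec_def L2_set_def sum_2)
qed

lemma orthogonal_transformation_rot: "orthogonal_transformation (rot t)"
  by (simp add: orthogonal_transformation linear_rot)

lemma rot_minus_rot: "rot (- t) (rot t x) = x" "rot t (rot (- t) x) = x"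
proof -
  have *: "rot (- s) (rot s x) = x" for s
  proof -
    have "c * (c * a - s * b) + s * (c * b + s * a) = (c\<^sup>2 + s\<^sup>2) * a"
      "c * (c * b + s * a) - s * (c * a - s * b) = (c\<^sup>2 + s\<^sup>2) * b" for a b c s :: real
      by algebra+
    then show ?thesis
      by (simp add: vec_eq_iff forall_2 rot_nth)
  qed
  show "rot (- t) (rot t x) = x" "rot t (rot (- t) x) = x"
    using *[of t] *[of "- t"] by simp_all
qed

lemma continuous_on_rot: "continuous_on UNIV (\<lambda>(t, x). rot t x)"
proof -
  have "continuous_on UNIV (\<lambda>z::real \<times> plane. if j = 1 then - (snd z $ 2) else snd z $ 1)" for j :: 2
    by (cases "j = 1") (auto intro!: continuous_intros)
  then show ?thesis
    unfolding rot_def case_prod_beta by (intro continuous_on_vec_lambda continuous_intros)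
qed

lemma continuous_on_rot_angle: "continuous_on S (\<lambda>t. rot t x)"
  unfolding rot_def by (intro continuous_on_vec_lambda continuous_intros)

text \<open>Lebesgue measure is determined by its values on boxes. The preimage of a box is its
  image under the inverse rotation, and orthogonal maps preserve measure.\<close>

lemma distr_lborel_rot: "distr lborel borel (rot t) = lborel"
proof (rule lborel_eqI[symmetric])
  fix l u :: plane
  assume le: "\<And>b. b \<in> Basis \<Longrightarrow> l \<bullet> b \<le> u \<bullet> b"
  have m: "rot t \<in> borel_measurable borel"
    using linear_continuous_on[OF linear_conv_bounded_linear[THEN iffD1, OF linear_rot]]
    by (rule borel_measurable_continuous_onI)
  have pre: "rot t -` box l u = rot (- t) ` box l u"
  proof (rule set_eqI)
    fix x show "x \<in> rot t -` box l u \<longleftrightarrow> x \<in> rot (- t) ` box l u"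
      unfolding vimage_eq image_iff using rot_minus_rot(1)[of t x] rot_minus_rot(2)[of t] by metis
  qed
  have "rot t -` box l u \<in> sets borel"
    using measurable_sets[OF m, of "box l u"] by simp
  then have "emeasure (distr lborel borel (rot t)) (box l u) = emeasure lebesgue (rot (- t) ` box l u)"
    using m by (simp add: emeasure_distr pre)
  also have "\<dots> = ennreal (measure lebesgue (rot (- t) ` box l u))"
    using measurable_orthogonal_image[OF orthogonal_transformation_rot, of "box l u" "- t"]
    by (simp add: emeasure_eq_measure2)
  also have "\<dots> = ennreal (measure lebesgue (box l u))"
    using measure_orthogonal_image[OF orthogonal_transformation_rot, of "box l u" "- t"] by simp
  also have "\<dots> = ennreal (\<Prod>b\<in>Basis. (u - l) \<bullet> b)"
    using le by simp
  finally show "emeasure (distr lborel borel (rot t)) (box l u) = ennreal (\<Prod>b\<in>Basis. (u - l) \<bullet> b)" .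
qed simp

lemma nn_integral_rot:
  assumes "f \<in> borel_measurable borel"
  shows "(\<integral>\<^sup>+x. f (rot t x) \<partial>lborel) = (\<integral>\<^sup>+x. f x \<partial>lborel)"
proof -
  have m: "rot t \<in> borel_measurable borel"
    using linear_continuous_on[OF linear_conv_bounded_linear[THEN iffD1, OF linear_rot]]
    by (rule borel_measurable_continuous_onI)
  have "(\<integral>\<^sup>+x. f x \<partial>distr lborel borel (rot t)) = (\<integral>\<^sup>+x. f (rot t x) \<partial>lborel)"
    using m assms by (intro nn_integral_distr) auto
  then show ?thesis
    by (simp add: distr_lborel_rot)
qed

section \<open>Estimates along half circles\<close>

lemma norm_matrix_vector_le:
  fixes A :: "real^'n^'m"
  shows "norm (A *v x) \<le> norm A * norm x"
proof -
  have "norm ((A *v x) $ j) \<le> norm (A $ j) * norm x" for j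
    using Cauchy_Schwarz_ineq2[of "A $ j" x]
    by (simp add: matrix_vector_mul_component)
  then have "norm (A *v x) \<le> L2_set (\<lambda>j. norm (A $ j) * norm x) UNIV"
    unfolding norm_vec_def[of "A *v x"] by (intro L2_set_mono) auto
  also have "\<dots> = norm A * norm x"
    by (simp add: norm_vec_def[of A] L2_set_left_distrib)
  finally show ?thesis .
qed

text \<open>Cauchy-Schwarz against the constant 1, obtained by expanding the nonnegative integral of
  (g - c)^2 with c the mean value of g.\<close>

lemma integral_squared_le:
  fixes g :: "real \<Rightarrow> real"
  assumes g: "continuous_on {a..b} g" and ab: "a \<le> b"
  shows "(integral {a..b} g)\<^sup>2 \<le> (b - a) * integral {a..b} (\<lambda>t. (g t)\<^sup>2)"
proof (cases "a = b")
  case False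
  define I c where "I = integral {a..b} g" and "c = I / (b - a)"
  have ab': "b - a > 0" using ab False by simp
  have i: "g integrable_on {a..b}" "(\<lambda>t. (g t)\<^sup>2) integrable_on {a..b}"
    using g by (auto intro!: integrable_continuous_interval continuous_intros)
  have "((\<lambda>t. (g t)\<^sup>2 - 2 * c * g t + c\<^sup>2) has_integral
      integral {a..b} (\<lambda>t. (g t)\<^sup>2) - 2 * c * I + (b - a) * c\<^sup>2) {a..b}"
    using has_integral_const_real[of "c\<^sup>2" a b] ab i unfolding I_def
    by (intro has_integral_add has_integral_diff has_integral_mult_right integrable_integral) auto
  moreover have "(g t)\<^sup>2 - 2 * c * g t + c\<^sup>2 = (g t - c)\<^sup>2" for t
    by (simp add: power2_diff mult_ac)
  ultimately have "((\<lambda>t. (g t - c)\<^sup>2) has_integral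
      integral {a..b} (\<lambda>t. (g t)\<^sup>2) - 2 * c * I + (b - a) * c\<^sup>2) {a..b}"
    by (simp only:)
  then have "0 \<le> integral {a..b} (\<lambda>t. (g t)\<^sup>2) - 2 * c * I + (b - a) * c\<^sup>2"
    by (rule has_integral_nonneg) simp
  then have "0 \<le> (b - a) * (integral {a..b} (\<lambda>t. (g t)\<^sup>2) - 2 * c * I + (b - a) * c\<^sup>2)"
    using ab' by simp
  also have "\<dots> = (b - a) * integral {a..b} (\<lambda>t. (g t)\<^sup>2) - I\<^sup>2"
  proof -
    have "I = c * (b - a)"
      using ab' by (simp add: c_def)
    then show ?thesis
      by algebra
  qed
  finally show ?thesis
    by (simp add: I_def)
qed simp

text \<open>The difference is the integral of the derivative of \<open>f\<close> along the half
  circle from x to -x, which has constant speed |x|. The factor pi is the length of the parameter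
  interval in Cauchy-Schwarz.\<close>

lemma antipodal_difference_le:
  fixes f :: "plane \<Rightarrow> plane"
  assumes f: "\<And>x. f differentiable (at x)" and J: "continuous_on UNIV (\<lambda>x. jacobian f (at x))"
  shows "(norm (f x - f (- x)))\<^sup>2 \<le>
    pi * (norm x)\<^sup>2 * integral {0..pi} (\<lambda>t. (norm (jacobian f (at (rot t x))))\<^sup>2)"
proof -
  define g where "g t = norm (jacobian f (at (rot t x)))" for t
  have gc: "continuous_on {0..pi} g"
    unfolding g_def by (intro continuous_on_norm continuous_on_compose2[OF J continuous_on_rot_angle]) auto
  \<comment> \<open>The velocity is the point of the circle a quarter turn ahead, so its norm is
    that of \<open>x\<close>.\<close>
  have rd: "((\<lambda>t. rot t x) has_vector_derivative rot (t + pi / 2) x) (at t within S)" for t S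
  proof -
    define y where "y = rot (pi / 2) x"
    have 1: "(\<lambda>s. rot s x) = (\<lambda>s. cos s *\<^sub>R x + sin s *\<^sub>R y)"
      by (rule ext) (simp add: y_def vec_eq_iff forall_2 rot_nth)
    have 2: "rot (t + pi / 2) x = (- sin t) *\<^sub>R x + cos t *\<^sub>R y"
      by (simp add: y_def vec_eq_iff forall_2 rot_nth cos_add sin_add)
    have "(cos has_real_derivative - sin t) (at t within S)" "(sin has_real_derivative cos t) (at t within S)"
      by (auto intro!: derivative_eq_intros)
    from has_vector_derivative_add[OF
        has_vector_derivative_scaleR[OF this(1) has_vector_derivative_const[of x]]
        has_vector_derivative_scaleR[OF this(2) has_vector_derivative_const[of y]]]
    show ?thesis
      unfolding 1 2 by simp
  qed
  have hd: "((\<lambda>t. f (rot t x)) has_vector_derivative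
      jacobian f (at (rot t x)) *v rot (t + pi / 2) x) (at t within {0..pi})" for t
  proof -
    have "(f has_derivative (\<lambda>h. jacobian f (at (rot t x)) *v h)) (at (rot t x))"
      using f jacobian_works by blast
    from has_derivative_compose[OF rd[unfolded has_vector_derivative_def] this]
    show ?thesis
      unfolding has_vector_derivative_def by (simp add: matrix_vector_mult_scaleR)
  qed
  have ftc: "((\<lambda>t. jacobian f (at (rot t x)) *v rot (t + pi / 2) x) has_integral
      f (rot pi x) - f (rot 0 x)) {0..pi}"
    by (intro fundamental_theorem_of_calculus hd) simp
  have gi: "g integrable_on {0..pi}"
    using gc by (rule integrable_continuous_interval)
  have "rot pi x = - x" "rot 0 x = x"
    by (simp_all add: vec_eq_iff forall_2 rot_nth)
  then have "norm (f x - f (- x)) = norm (integral {0..pi} (\<lambda>t. jacobian f (at (rot t x)) *v rot (t + pi / 2) x))"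
    using integral_unique[OF ftc] by (simp add: norm_minus_commute)
  also have "\<dots> \<le> integral {0..pi} (\<lambda>t. g t * norm x)"
    using ftc gi norm_matrix_vector_le[of "jacobian f (at (rot t x))" "rot (t + pi / 2) x" for t]
    by (intro integral_norm_bound_integral has_integral_integrable[OF ftc] integrable_on_mult_left gi)
      (simp add: g_def)
  also have "\<dots> = integral {0..pi} g * norm x"
    by simp
  finally have "(norm (f x - f (- x)))\<^sup>2 \<le> (integral {0..pi} g * norm x)\<^sup>2"
    by (intro power_mono) auto
  also have "\<dots> = (integral {0..pi} g)\<^sup>2 * (norm x)\<^sup>2"
    by (simp add: power_mult_distrib)
  also have "\<dots> \<le> (pi * integral {0..pi} (\<lambda>t. (g t)\<^sup>2)) * (norm x)\<^sup>2"
    using integral_squared_le[OF gc] by (intro mult_right_mono) auto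
  finally show ?thesis
    by (simp add: g_def mult_ac)
qed

text \<open>Stated with nonnegative integrals, so that no integrability has to be provided before
  Fatou's lemma is applied.\<close>

lemma antipodal_hardy_inequality:
  fixes f :: "plane \<Rightarrow> plane"
  assumes f: "\<And>x. f differentiable (at x)" and J: "continuous_on UNIV (\<lambda>x. jacobian f (at x))"
  shows "(\<integral>\<^sup>+x. ennreal ((norm (f x - f (- x)) / norm x)\<^sup>2) \<partial>lborel) \<le>
    ennreal (pi\<^sup>2) * (\<integral>\<^sup>+x. ennreal ((norm (jacobian f (at x)))\<^sup>2) \<partial>lborel)"
proof -
  define G where "G x = ennreal ((norm (jacobian f (at x)))\<^sup>2)" for x
  have Gm [measurable]: "G \<in> borel_measurable borel"
    unfolding G_def by (intro measurable_compose[OF _ measurable_ennreal] borel_measurable_continuous_onI continuous_intros J)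
  have rm [measurable]: "(\<lambda>(t, x). rot t x) \<in> borel_measurable (borel \<Otimes>\<^sub>M borel)"
    using borel_measurable_continuous_onI[OF continuous_on_rot] by (simp add: borel_prod)
  have pointwise: "ennreal ((norm (f x - f (- x)) / norm x)\<^sup>2) \<le>
      ennreal pi * (\<integral>\<^sup>+t. indicator {0..pi} t * G (rot t x) \<partial>lborel)" for x
  proof -
    define I where "I = integral {0..pi} (\<lambda>t. (norm (jacobian f (at (rot t x))))\<^sup>2)"
    have c: "continuous_on UNIV (\<lambda>t. (norm (jacobian f (at (rot t x))))\<^sup>2)"
      by (intro continuous_intros continuous_on_compose2[OF J continuous_on_rot_angle]) auto
    have I: "((\<lambda>t. (norm (jacobian f (at (rot t x))))\<^sup>2) has_integral I) {0..pi}"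
      unfolding I_def
      by (intro integrable_integral integrable_continuous_interval continuous_on_subset[OF c]) simp
    have "indicator {0..pi} t * ennreal ((norm (jacobian f (at (rot t x))))\<^sup>2) =
        ennreal (indicator {0..pi} t * (norm (jacobian f (at (rot t x))))\<^sup>2)" for t
      by (simp split: split_indicator)
    then have "(\<integral>\<^sup>+t. indicator {0..pi} t * ennreal ((norm (jacobian f (at (rot t x))))\<^sup>2) \<partial>lborel) = ennreal I"
      using nn_integral_has_integral_lebesgue[OF _ I] by simp
    moreover have "I \<ge> 0"
      unfolding I_def by (intro integral_nonneg integrable_continuous_interval continuous_on_subset[OF c]) auto
    moreover have "(norm (f x - f (- x)) / norm x)\<^sup>2 \<le> pi * I"
    \<comment> \<open>At the origin the quotient is 0 by the convention for division by
      zero.\<close>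
    proof (cases "x = 0")
      case True
      then show ?thesis using \<open>I \<ge> 0\<close> by simp
    next
      case False
      then show ?thesis
        using antipodal_difference_le[OF f J, of x]
        by (simp add: I_def power_divide divide_le_eq mult_ac)
    qed
    ultimately show ?thesis
      by (simp add: G_def ennreal_mult[symmetric] ennreal_leI)
  qed
  have "(\<integral>\<^sup>+x. ennreal ((norm (f x - f (- x)) / norm x)\<^sup>2) \<partial>lborel) \<le>
      (\<integral>\<^sup>+x. ennreal pi * (\<integral>\<^sup>+t. indicator {0..pi} t * G (rot t x) \<partial>lborel) \<partial>lborel)"
    by (intro nn_integral_mono pointwise)
  also have "\<dots> = ennreal pi * (\<integral>\<^sup>+x. (\<integral>\<^sup>+t. indicator {0..pi} t * G (rot t x) \<partial>lborel) \<partial>lborel)"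
    by (intro nn_integral_cmult) measurable
  \<comment> \<open>Tonelli. Afterwards the inner integral is independent of the angle by rotation
    invariance, and the integral over the angles yields the second factor pi.\<close>
  also have "(\<integral>\<^sup>+x. (\<integral>\<^sup>+t. indicator {0..pi} t * G (rot t x) \<partial>lborel) \<partial>lborel) =
      (\<integral>\<^sup>+t. (\<integral>\<^sup>+x. indicator {0..pi} t * G (rot t x) \<partial>lborel) \<partial>lborel)"
    by (rule lborel_pair.Fubini') measurable
  also have "\<dots> = (\<integral>\<^sup>+t. indicator {0..pi} t * (\<integral>\<^sup>+x. G x \<partial>lborel) \<partial>lborel)"
    by (intro nn_integral_cong) (simp add: nn_integral_cmult nn_integral_rot)
  also have "\<dots> = ennreal pi * (\<integral>\<^sup>+x. G x \<partial>lborel)"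
    by (subst nn_integral_multc) auto
  also have "ennreal pi * (ennreal pi * (\<integral>\<^sup>+x. G x \<partial>lborel)) = ennreal (pi\<^sup>2) * (\<integral>\<^sup>+x. G x \<partial>lborel)"
    by (simp only: power2_eq_square ennreal_mult[OF pi_ge_zero pi_ge_zero] mult.assoc)
  finally show ?thesis
    by (simp only: G_def)
qed

section \<open>Centrally symmetric fields\<close>

lemma jacobian_nth: "jacobian f (at x) $ j $ i = partial_deriv i f x $ j"
  by (simp add: jacobian_def matrix_def partial_deriv_def)

text \<open>Off the closed support the field vanishes on a whole neighbourhood of the point.\<close>

lemma jacobian_outside_support:
  fixes f :: "plane \<Rightarrow> plane"
  assumes "x \<notin> closure {x. f x \<noteq> 0}"
  shows "jacobian f (at x) = 0"
proof -
  have "frechet_derivative (\<lambda>x. 0) (at x) = frechet_derivative f (at x)"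
  proof (rule frechet_derivative_transform_within_open[where X = "- closure {x. f x \<noteq> 0}"])
    fix y assume "y \<in> - closure {x. f x \<noteq> 0}"
    then show "0 = f y"
      using closure_subset[of "{x. f x \<noteq> 0}"] by auto
  qed (use assms in auto)
  then show ?thesis
    by (simp add: jacobian_def matrix_def vec_eq_iff flip: \<open>frechet_derivative (\<lambda>x. 0) (at x) = frechet_derivative f (at x)\<close>)
qed

lemma smooth_compact_supportD:
  fixes f :: "plane \<Rightarrow> plane"
  assumes "f \<in> smooth_compact_support \<Omega>"
  shows "f differentiable (at x)" "continuous_on UNIV f" "continuous_on UNIV (\<lambda>x. jacobian f (at x))"
    and "x \<notin> \<Omega> \<Longrightarrow> f x = 0" "x \<notin> \<Omega> \<Longrightarrow> jacobian f (at x) = 0"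
proof -
  have C: "Ck k f" for k
    using assms unfolding smooth_compact_support_def by auto
  have S: "closure {x. f x \<noteq> 0} \<subseteq> \<Omega>"
    using assms unfolding smooth_compact_support_def by auto
  show "f differentiable (at x)" "continuous_on UNIV f"
    using C[of "Suc 0"] C[of 0] by simp_all
  have "continuous_on UNIV (\<lambda>x. partial_deriv i f x)" for i
    using C[of "Suc 0"] by simp
  then have "continuous_on UNIV (\<lambda>x. \<chi> j i. partial_deriv i f x $ j)"
    by (intro continuous_on_vec_lambda continuous_on_component)
  moreover have "(\<lambda>x. jacobian f (at x)) = (\<lambda>x. \<chi> j i. partial_deriv i f x $ j)"
    by (simp add: fun_eq_iff vec_eq_iff jacobian_nth)
  ultimately show "continuous_on UNIV (\<lambda>x. jacobian f (at x))"
    by (simp only:)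
  show "f x = 0" "jacobian f (at x) = 0" if "x \<notin> \<Omega>"
    using that S closure_subset[of "{x. f x \<noteq> 0}"] jacobian_outside_support[of x f] by auto
qed

lemma jacobian_in_L2:
  fixes f :: "plane \<Rightarrow> plane"
  assumes f: "f \<in> smooth_compact_support \<Omega>" and \<Omega>: "open \<Omega>"
  shows "(\<lambda>x. jacobian f (at x)) \<in> L2 \<Omega>"
proof -
  let ?K = "closure {x. f x \<noteq> 0}"
  have K: "compact ?K" "?K \<subseteq> \<Omega>"
    using f unfolding smooth_compact_support_def by auto
  have c: "continuous_on S (\<lambda>x. jacobian f (at x))" for S
    using smooth_compact_supportD(3)[OF f] continuous_on_subset by blast
  have "integrable lborel (\<lambda>x. indicator ?K x *\<^sub>R (norm (jacobian f (at x)))\<^sup>2)"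
    by (intro borel_integrable_compact K continuous_intros c)
  then have "integrable lebesgue (\<lambda>x. indicator ?K x *\<^sub>R (norm (jacobian f (at x)))\<^sup>2)"
    by (subst integrable_completion) auto
  also have "(\<lambda>x. indicator ?K x *\<^sub>R (norm (jacobian f (at x)))\<^sup>2) =
      (\<lambda>x. indicator \<Omega> x *\<^sub>R (norm (jacobian f (at x)))\<^sup>2)"
    using K(2) jacobian_outside_support[of _ f] by (auto simp: fun_eq_iff split: split_indicator)
  finally have "integrable (lebesgue_on \<Omega>) (\<lambda>x. (norm (jacobian f (at x)))\<^sup>2)"
    using \<Omega> by (subst integrable_restrict_space) auto
  moreover have "(\<lambda>x. jacobian f (at x)) \<in> borel_measurable (lebesgue_on \<Omega>)"
    using \<Omega> by (intro continuous_imp_measurable_on_sets_lebesgue c) auto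
  ultimately show ?thesis
    by (simp add: L2_def)
qed

lemma norm_add_squared_le:
  fixes a b :: "'a::real_normed_vector"
  shows "(norm (a + b))\<^sup>2 \<le> 2 * (norm a)\<^sup>2 + 2 * (norm b)\<^sup>2"
proof -
  have "(norm (a + b))\<^sup>2 \<le> (norm a + norm b)\<^sup>2"
    by (intro power_mono norm_triangle_ineq) simp
  also have "\<dots> \<le> 2 * (norm a)\<^sup>2 + 2 * (norm b)\<^sup>2"
    using sum_squares_bound[of "norm a" "norm b"] by (simp add: power2_sum)
  finally show ?thesis .
qed

text \<open>The squared bound with factors 2 replaces the triangle inequality; this only enlarges
  the final constant.\<close>

lemma L2_add:
  assumes "f \<in> L2 S" "g \<in> L2 S"
  shows "(\<lambda>x. f x + g x) \<in> L2 S"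
    and "(L2_norm S (\<lambda>x. f x + g x))\<^sup>2 \<le> 2 * (L2_norm S f)\<^sup>2 + 2 * (L2_norm S g)\<^sup>2"
proof -
  have m: "f \<in> borel_measurable (lebesgue_on S)" "g \<in> borel_measurable (lebesgue_on S)"
    and i: "integrable (lebesgue_on S) (\<lambda>x. (norm (f x))\<^sup>2)" "integrable (lebesgue_on S) (\<lambda>x. (norm (g x))\<^sup>2)"
    using assms by (auto simp: L2_def)
  have i2: "integrable (lebesgue_on S) (\<lambda>x. 2 * (norm (f x))\<^sup>2 + 2 * (norm (g x))\<^sup>2)"
    using i by simp
  have i3: "integrable (lebesgue_on S) (\<lambda>x. (norm (f x + g x))\<^sup>2)"
    by (rule Bochner_Integration.integrable_bound[OF i2])
      (use m norm_add_squared_le[of "f _" "g _"] in auto)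
  show "(\<lambda>x. f x + g x) \<in> L2 S"
    using m i3 by (simp add: L2_def)
  have "(LINT x|lebesgue_on S. (norm (f x + g x))\<^sup>2) \<le>
      (LINT x|lebesgue_on S. 2 * (norm (f x))\<^sup>2 + 2 * (norm (g x))\<^sup>2)"
    by (intro integral_mono i2 i3 norm_add_squared_le)
  also have "\<dots> = 2 * (LINT x|lebesgue_on S. (norm (f x))\<^sup>2) + 2 * (LINT x|lebesgue_on S. (norm (g x))\<^sup>2)"
    using i by simp
  finally show "(L2_norm S (\<lambda>x. f x + g x))\<^sup>2 \<le> 2 * (L2_norm S f)\<^sup>2 + 2 * (L2_norm S g)\<^sup>2"
    by (simp add: L2_norm_def)
qed

lemma nn_integral_eq_L2_norm:
  assumes "f \<in> L2 S"
  shows "(\<integral>\<^sup>+x. ennreal ((norm (f x))\<^sup>2) \<partial>lebesgue_on S) = ennreal ((L2_norm S f)\<^sup>2)"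
  using assms by (simp add: L2_def L2_norm_def nn_integral_eq_integral)

text \<open>Convergence in L2 means that the squared distances tend to 0 in L1, which gives a
  subsequence along which they tend to 0 almost everywhere.\<close>

lemma L2_tendsto_AE_subseq:
  assumes "L2_tendsto S f g"
  shows "\<exists>r. strict_mono r \<and> (AE x in lebesgue_on S. (\<lambda>n. f (r n) x) \<longlonglongrightarrow> g x)"
proof -
  let ?d = "\<lambda>n x. (norm (f n x - g x))\<^sup>2"
  have i: "integrable (lebesgue_on S) (?d n)" for n
    using assms by (simp add: L2_tendsto_def L2_def)
  have "(\<lambda>n. (L2_norm S (\<lambda>x. f n x - g x))\<^sup>2) \<longlonglongrightarrow> 0\<^sup>2"
    using assms unfolding L2_tendsto_def by (intro tendsto_power) simp
  then have "(\<lambda>n. LINT x|lebesgue_on S. norm (?d n x)) \<longlonglongrightarrow> 0"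
    by (simp add: L2_norm_def)
  from tendsto_L1_AE_subseq[OF i this]
  obtain r where r: "strict_mono r" "AE x in lebesgue_on S. (\<lambda>n. ?d (r n) x) \<longlonglongrightarrow> 0"
    by blast
  from r(2) have "AE x in lebesgue_on S. (\<lambda>n. f (r n) x) \<longlonglongrightarrow> g x"
  proof eventually_elim
    case (elim x)
    then have "(\<lambda>n. sqrt (?d (r n) x)) \<longlonglongrightarrow> sqrt 0"
      by (intro tendsto_real_sqrt)
    then show ?case
      by (simp add: tendsto_norm_zero_iff LIM_zero_iff)
  qed
  with r(1) show ?thesis by blast
qed

text \<open>The reflection of a null set is its image under a differentiable map, hence null. This
  makes convergence at x and at -x available simultaneously.\<close>

lemma AE_lebesgue_uminus:
  fixes P :: "plane \<Rightarrow> bool"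
  assumes "AE x in lebesgue. P x"
  shows "AE x in lebesgue. P (- x)"
proof -
  obtain N where N': "{x \<in> space lebesgue. \<not> P x} \<subseteq> N" "emeasure lebesgue N = 0" "N \<in> sets lebesgue"
    by (rule AE_E[OF assms])
  then have N: "N \<in> null_sets lebesgue" "{x. \<not> P x} \<subseteq> N"
    by (auto intro: null_setsI)
  have "negligible (uminus ` N)"
    using N(1) by (intro negligible_differentiable_image_negligible) (simp_all add: negligible_iff_null_sets differentiable_on_minus differentiable_on_ident)
  then show ?thesis
  proof (intro AE_I'[of "uminus ` N"] subsetI)
    show "x \<in> uminus ` N" if "x \<in> {x \<in> space lebesgue. \<not> P (- x)}" for x
      using that N(2) by (intro image_eqI[of _ _ "- x"]) auto
  qed (simp add: negligible_iff_null_sets)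
qed

section \<open>The Hardy inequality for symmetric fields\<close>

lemma centrally_symmetric_hardy:
  assumes \<Omega>: "open \<Omega>"
    and v: "v \<in> borel_measurable (lebesgue_on \<Omega>)" "centrally_symmetric \<Omega> v"
    and \<phi>: "\<And>n. \<phi> n \<in> smooth_compact_support \<Omega>"
    and lim: "\<And>R. R > 0 \<Longrightarrow> L2_tendsto (\<Omega> \<inter> ball 0 R) \<phi> v"
    and bound: "\<And>n. (L2_norm \<Omega> (\<lambda>x. jacobian (\<phi> n) (at x)))\<^sup>2 \<le> K n" "K \<longlonglongrightarrow> k"
  shows "(\<integral>\<^sup>+x. ennreal ((norm (v x) / norm x)\<^sup>2) \<partial>lebesgue_on \<Omega>) \<le> ennreal (pi\<^sup>2 / 4 * k)"
proof -
  \<comment> \<open>No symmetry of \<open>\<Omega>\<close> is assumed, so -x may lie outside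
    \<open>\<Omega>\<close>; the extension by zero gives the value there its meaning.\<close>
  define w where "w = zero_extension \<Omega> v"
  define F where "F x = ennreal ((norm (2 *\<^sub>R w x) / norm x)\<^sup>2)" for x
  have w_meas [measurable]: "w \<in> borel_measurable lebesgue"
    using v(1) \<Omega> borel_measurable_if[of \<Omega> v] unfolding w_def zero_extension_def[abs_def] by simp
  have id_meas [measurable]: "(\<lambda>x::plane. x) \<in> borel_measurable lebesgue"
    by (simp add: measurable_completion)
  have F_meas [measurable]: "F \<in> borel_measurable lebesgue"
    unfolding F_def by measurable
  have test: "(\<integral>\<^sup>+x. ennreal ((norm (\<phi> n x - \<phi> n (- x)) / norm x)\<^sup>2) \<partial>lebesgue) \<le> ennreal (pi\<^sup>2 * K n)" for n
  proof -
    have J: "(\<lambda>x. jacobian (\<phi> n) (at x)) \<in> L2 \<Omega>"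
      by (rule jacobian_in_L2[OF \<phi> \<Omega>])
    have "(\<integral>\<^sup>+x. ennreal ((norm (jacobian (\<phi> n) (at x)))\<^sup>2) \<partial>lebesgue) =
        (\<integral>\<^sup>+x. ennreal ((norm (jacobian (\<phi> n) (at x)))\<^sup>2) * indicator \<Omega> x \<partial>lebesgue)"
      using smooth_compact_supportD(5)[OF \<phi>]
      by (intro nn_integral_cong) (auto split: split_indicator)
    also have "\<dots> = (\<integral>\<^sup>+x. ennreal ((norm (jacobian (\<phi> n) (at x)))\<^sup>2) \<partial>lebesgue_on \<Omega>)"
      using \<Omega> by (subst nn_integral_restrict_space) auto
    also have "\<dots> \<le> ennreal (K n)"
      using nn_integral_eq_L2_norm[OF J] bound(1)[of n] by (simp add: ennreal_leI)
    finally have "ennreal (pi\<^sup>2) * (\<integral>\<^sup>+x. ennreal ((norm (jacobian (\<phi> n) (at x)))\<^sup>2) \<partial>lborel) \<le> ennreal (pi\<^sup>2) * ennreal (K n)"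
      by (intro mult_left_mono) (simp_all add: nn_integral_completion)
    moreover have "K n \<ge> 0"
      using bound(1)[of n] by (meson order_trans zero_le_power2)
    ultimately show ?thesis
      using antipodal_hardy_inequality[OF smooth_compact_supportD(1,3)[OF \<phi>], of n]
      by (simp add: nn_integral_completion ennreal_mult)
  qed
  \<comment> \<open>The approximation is assumed on bounded parts only, so Fatou's lemma is first
    applied on a ball. The ball is symmetric, hence contains -x together with x.\<close>
  have ball: "(\<integral>\<^sup>+x. F x * indicator (ball 0 R) x \<partial>lebesgue) \<le> ennreal (pi\<^sup>2 * k)" if R: "R > 0" for R
  proof -
    obtain r where r: "strict_mono r" "AE x in lebesgue_on (\<Omega> \<inter> ball 0 R). (\<lambda>n. \<phi> (r n) x) \<longlonglongrightarrow> v x"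
      using L2_tendsto_AE_subseq[OF lim[OF R]] by blast
    from r(2) have "AE x in lebesgue. x \<in> \<Omega> \<inter> ball 0 R \<longrightarrow> (\<lambda>n. \<phi> (r n) x) \<longlonglongrightarrow> v x"
      using \<Omega> by (subst (asm) AE_restrict_space_iff) auto
    \<comment> \<open>Outside \<open>\<Omega>\<close> the test fields and \<open>w\<close> are both
      0, so the convergence extends to the whole ball.\<close>
    then have conv: "AE x in lebesgue. x \<in> ball 0 R \<longrightarrow> (\<lambda>n. \<phi> (r n) x) \<longlonglongrightarrow> w x"
    proof eventually_elim
      case (elim x)
      then show ?case
        using smooth_compact_supportD(4)[OF \<phi>, of x] by (auto simp: w_def zero_extension_def)
    qed
    define H where "H n x = ennreal ((norm (\<phi> (r n) x - \<phi> (r n) (- x)) / norm x)\<^sup>2)" for n x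
    have H_meas: "H n \<in> borel_measurable lebesgue" for n
    proof -
      have [measurable]: "\<phi> (r n) \<in> borel_measurable borel"
        using smooth_compact_supportD(2)[OF \<phi>] by (rule borel_measurable_continuous_onI)
      have "H n \<in> borel_measurable borel"
        unfolding H_def by measurable
      then show ?thesis
        by (simp add: measurable_completion)
    qed
    have "AE x in lebesgue. F x * indicator (ball 0 R) x \<le> liminf (\<lambda>n. H n x)"
      using conv AE_lebesgue_uminus[OF conv] v(2)[unfolded centrally_symmetric_def, folded w_def]
    proof eventually_elim
      case (elim x)
      show ?case
      proof (cases "x \<in> ball 0 R \<and> x \<noteq> 0")
        case True
        then have "(\<lambda>n. \<phi> (r n) x) \<longlonglongrightarrow> w x" "(\<lambda>n. \<phi> (r n) (- x)) \<longlonglongrightarrow> w (- x)"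
          using elim by auto
        then have "(\<lambda>n. H n x) \<longlonglongrightarrow> ennreal ((norm (w x - w (- x)) / norm x)\<^sup>2)"
          unfolding H_def using True by (intro tendsto_intros tendsto_ennrealI) auto
        moreover have "w x - w (- x) = 2 *\<^sub>R w x"
          using elim(3) by (simp add: scaleR_2)
        ultimately have "(\<lambda>n. H n x) \<longlonglongrightarrow> F x"
          by (simp only: F_def)
        then show ?thesis
          using True by (simp add: lim_imp_Liminf)
      qed (auto simp: F_def)
    qed
    then have "(\<integral>\<^sup>+x. F x * indicator (ball 0 R) x \<partial>lebesgue) \<le> (\<integral>\<^sup>+x. liminf (\<lambda>n. H n x) \<partial>lebesgue)"
      by (rule nn_integral_mono_AE)
    also have "\<dots> \<le> liminf (\<lambda>n. \<integral>\<^sup>+x. H n x \<partial>lebesgue)"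
      by (rule nn_integral_liminf[OF H_meas])
    also have "\<dots> \<le> liminf (\<lambda>n. ennreal (pi\<^sup>2 * K (r n)))"
      unfolding H_def by (intro Liminf_mono always_eventually allI test)
    also have "\<dots> = ennreal (pi\<^sup>2 * k)"
      using LIMSEQ_subseq_LIMSEQ[OF bound(2) r(1)]
      by (intro lim_imp_Liminf tendsto_ennrealI tendsto_mult tendsto_const) (auto simp: o_def)
    finally show ?thesis .
  qed
  \<comment> \<open>A second use of Fatou's lemma lets the radius tend to infinity;
    \<open>Suc n\<close> keeps the radius positive.\<close>
  have "(\<integral>\<^sup>+x. F x \<partial>lebesgue) \<le> (\<integral>\<^sup>+x. liminf (\<lambda>n. F x * indicator (ball 0 (real (Suc n))) x) \<partial>lebesgue)"
  proof (rule nn_integral_mono)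
    fix x :: plane
    have "\<forall>\<^sub>F n in sequentially. F x = F x * indicator (ball 0 (real (Suc n))) x"
      using eventually_ge_at_top[of "nat \<lceil>norm x\<rceil>"]
      by eventually_elim (auto split: split_indicator simp: nat_le_iff ceiling_le_iff)
    then show "F x \<le> liminf (\<lambda>n. F x * indicator (ball 0 (real (Suc n))) x)"
      by (intro Liminf_bounded) (erule eventually_mono, rule eq_refl)
  qed
  also have "\<dots> \<le> liminf (\<lambda>n. \<integral>\<^sup>+x. F x * indicator (ball 0 (real (Suc n))) x \<partial>lebesgue)"
    by (intro nn_integral_liminf borel_measurable_times_ennreal F_meas borel_measurable_indicator) simp
  also have "\<dots> \<le> liminf (\<lambda>n::nat. ennreal (pi\<^sup>2 * k))"
    by (intro Liminf_mono always_eventually allI ball) simp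
  finally have total: "(\<integral>\<^sup>+x. F x \<partial>lebesgue) \<le> ennreal (pi\<^sup>2 * k)"
    by (simp add: Liminf_const)
  have "(\<integral>\<^sup>+x. ennreal ((norm (v x) / norm x)\<^sup>2) \<partial>lebesgue_on \<Omega>) =
      (\<integral>\<^sup>+x. ennreal ((norm (v x) / norm x)\<^sup>2) * indicator \<Omega> x \<partial>lebesgue)"
    using \<Omega> by (subst nn_integral_restrict_space) auto
  \<comment> \<open>The factor 1/4 undoes the doubling of \<open>w\<close> in
    \<open>F\<close>.\<close>
  also have "\<dots> = (\<integral>\<^sup>+x. ennreal (1 / 4) * F x \<partial>lebesgue)"
    by (intro nn_integral_cong)
      (auto simp: F_def w_def zero_extension_def power_divide power_mult_distrib
        ennreal_mult[symmetric] split: split_indicator)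
  also have "\<dots> = ennreal (1 / 4) * (\<integral>\<^sup>+x. F x \<partial>lebesgue)"
    by (rule nn_integral_cmult) measurable
  also have "\<dots> \<le> ennreal (1 / 4) * ennreal (pi\<^sup>2 * k)"
    by (intro mult_left_mono total) simp
  also have "\<dots> = ennreal (1 / 4 * (pi\<^sup>2 * k))"
    by (rule ennreal_mult'[symmetric]) simp
  also have "1 / 4 * (pi\<^sup>2 * k) = pi\<^sup>2 / 4 * k"
    by simp
  finally show ?thesis .
qed

section \<open>The bound for the trilinear form\<close>

lemma borel_measurable_component:
  fixes f :: "'a \<Rightarrow> 'b::real_normed_vector^'n"
  assumes "f \<in> borel_measurable M"
  shows "(\<lambda>x. f x $ i) \<in> borel_measurable M"
  by (rule borel_measurable_continuous_on[OF _ assms, of "\<lambda>y. y $ i"]) (intro continuous_intros)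

text \<open>As row j, column i of the gradient holds the i-th derivative of the j-th component, the
  integrand is the inner product of \<open>u x\<close> with \<open>D x *v v x\<close>.\<close>

lemma abs_convection_integrand_le:
  "\<bar>convection_integrand v D u x\<bar> \<le> norm (u x) * (norm (D x) * norm (v x))"
proof -
  have "convection_integrand v D u x = u x \<bullet> (D x *v v x)"
    by (simp add: convection_integrand_def inner_vec_def matrix_vector_mult_def sum_2 algebra_simps)
  also have "\<bar>\<dots>\<bar> \<le> norm (u x) * norm (D x *v v x)"
    by (rule Cauchy_Schwarz_ineq2)
  also have "\<dots> \<le> norm (u x) * (norm (D x) * norm (v x))"
    by (intro mult_left_mono norm_matrix_vector_le) simp
  finally show ?thesis .
qed

theorem lemma7:
  fixes B \<Omega> :: "plane set"
  assumes "admissible_obstacle B" and "\<Omega> = exterior_domain B"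
  shows "\<exists>C>0. \<forall>u \<in> borel_measurable (lebesgue_on \<Omega>). \<forall>\<delta>>0.
           (SUP x\<in>\<Omega>. ereal (norm x * norm (u x))) \<le> ereal (\<delta> / C) \<longrightarrow>
           (\<forall>v \<in> H1_dot_0_sigma \<Omega>. \<forall>Dv.
              centrally_symmetric \<Omega> v \<and> has_weak_gradient \<Omega> v Dv \<longrightarrow>
              integrable (lebesgue_on \<Omega>) (convection_integrand v Dv u) \<and>
              \<bar>LINT x|lebesgue_on \<Omega>. convection_integrand v Dv u x\<bar> \<le> \<delta> * (L2_norm \<Omega> Dv)\<^sup>2)"
proof -
  \<comment> \<open>Young's inequality bounds the product by half of \<open>q x\<close> plus the
    squared norm of \<open>Dv x\<close>, and the integral of \<open>q\<close> is at most pi^2/2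
    times the squared norm of the gradient. \<open>C\<close> is half the sum of pi^2/2 and 1, the
    same number for all obstacles.\<close>
  define C where "C = (pi\<^sup>2 / 2 + 1) / 2"
  have C: "C > 0"
    by (simp add: C_def add_nonneg_pos)
  have \<Omega>: "open \<Omega>"
    using assms(2) by (simp add: exterior_domain_def open_Compl)
  have \<Omega>0: "x \<noteq> 0" if "x \<in> \<Omega>" for x
    using assms that closure_subset[of B] by (auto simp: exterior_domain_def admissible_obstacle_def)
  have "integrable (lebesgue_on \<Omega>) (convection_integrand v Dv u) \<and>
      \<bar>LINT x|lebesgue_on \<Omega>. convection_integrand v Dv u x\<bar> \<le> \<delta> * (L2_norm \<Omega> Dv)\<^sup>2"
    if u: "u \<in> borel_measurable (lebesgue_on \<Omega>)" and \<delta>: "\<delta> > 0"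
      and sup: "(SUP x\<in>\<Omega>. ereal (norm x * norm (u x))) \<le> ereal (\<delta> / C)"
      and v: "v \<in> H1_dot_0_sigma \<Omega>" and sym: "centrally_symmetric \<Omega> v"
      and Dv: "has_weak_gradient \<Omega> v Dv" for u \<delta> v Dv
  proof -
    let ?M = "lebesgue_on \<Omega>"
    obtain D \<phi> where D: "has_weak_gradient \<Omega> v D" and \<phi>: "\<And>n. \<phi> n \<in> smooth_solenoidal \<Omega>"
      and conv: "\<And>R. R > 0 \<Longrightarrow> L2_tendsto (\<Omega> \<inter> ball 0 R) \<phi> v"
      and conv': "L2_tendsto \<Omega> (\<lambda>n x. jacobian (\<phi> n) (at x)) D"
      using v unfolding H1_dot_0_sigma_def by blast
    have \<phi>': "\<phi> n \<in> smooth_compact_support \<Omega>" for n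
      using \<phi> by (simp add: smooth_solenoidal_def)
    have v_meas [measurable]: "v \<in> borel_measurable ?M" and Dv_meas [measurable]: "Dv \<in> borel_measurable ?M"
      and D_meas [measurable]: "D \<in> borel_measurable ?M"
      using D Dv \<Omega> unfolding has_weak_gradient_def by (auto intro: locally_integrable_measurable)
    note u [measurable]
    have AE_eq: "AE x in ?M. Dv x = D x"
      by (rule weak_gradient_unique[OF Dv D \<Omega>])
    let ?J = "\<lambda>n x. jacobian (\<phi> n) (at x)"
    have J: "?J n \<in> L2 \<Omega>" and JD: "(\<lambda>x. ?J n x - D x) \<in> L2 \<Omega>" for n
      using jacobian_in_L2[OF \<phi>' \<Omega>] conv' by (auto simp: L2_tendsto_def)
    \<comment> \<open>The definition of the space places only the differences
      \<open>?J n x - D x\<close> in L2; \<open>D\<close> itself is recovered as \<open>?J 0\<close>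
      minus such a difference.\<close>
    have "(\<lambda>x. - (?J 0 x - D x)) \<in> L2 \<Omega>"
      using JD[of 0] borel_measurable_uminus[of "\<lambda>x. ?J 0 x - D x" ?M]
      unfolding L2_def mem_Collect_eq norm_minus_cancel by (simp only: simp_thms)
    from L2_add(1)[OF J[of 0] this] have D_L2: "D \<in> L2 \<Omega>"
      by simp
    have "integrable ?M (\<lambda>x. (norm (Dv x))\<^sup>2) \<longleftrightarrow> integrable ?M (\<lambda>x. (norm (D x))\<^sup>2)"
      using AE_eq by (intro integrable_cong_AE) auto
    then have Dv_int: "integrable ?M (\<lambda>x. (norm (Dv x))\<^sup>2)"
      using D_L2 by (simp add: L2_def)
    have Dv_norm: "(LINT x|?M. (norm (Dv x))\<^sup>2) = (L2_norm \<Omega> Dv)\<^sup>2"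
      by (simp add: L2_norm_def)
    have "(LINT x|?M. (norm (D x))\<^sup>2) = (LINT x|?M. (norm (Dv x))\<^sup>2)"
      using AE_eq by (intro integral_cong_AE) auto
    then have norm_eq: "L2_norm \<Omega> D = L2_norm \<Omega> Dv"
      by (simp add: L2_norm_def)
    \<comment> \<open>Splitting the test gradient as D plus an error that tends to 0 in L2 gives
      this bound. Its limit carries the factor 2 that turns pi^2/4 into pi^2/2.\<close>
    define K where "K n = 2 * (L2_norm \<Omega> D)\<^sup>2 + 2 * (L2_norm \<Omega> (\<lambda>x. ?J n x - D x))\<^sup>2" for n
    have K: "(L2_norm \<Omega> (?J n))\<^sup>2 \<le> K n" for n
      using L2_add(2)[OF D_L2 JD[of n]] by (simp add: K_def)
    have "K \<longlonglongrightarrow> 2 * (L2_norm \<Omega> D)\<^sup>2 + 2 * 0\<^sup>2"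
      unfolding K_def using conv' by (intro tendsto_intros) (simp add: L2_tendsto_def)
    then have K_lim: "K \<longlonglongrightarrow> 2 * (L2_norm \<Omega> Dv)\<^sup>2"
      by (simp add: norm_eq)
    define q where "q x = (norm (v x) / norm x)\<^sup>2" for x
    have id_meas [measurable]: "(\<lambda>x. x) \<in> borel_measurable ?M"
      using id_borel_measurable_lebesgue_on[of \<Omega>] by (simp add: id_def)
    have q_nonneg: "q x \<ge> 0" for x
      by (simp add: q_def)
    have q_meas [measurable]: "q \<in> borel_measurable ?M"
      unfolding q_def by measurable
    have hardy: "(\<integral>\<^sup>+x. ennreal (q x) \<partial>?M) \<le> ennreal (pi\<^sup>2 / 2 * (L2_norm \<Omega> Dv)\<^sup>2)"
      using centrally_symmetric_hardy[OF \<Omega> v_meas sym \<phi>' conv K K_lim] by (simp add: q_def)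
    have q_int: "integrable ?M q"
      using hardy by (intro integrableI_nonneg) (auto simp: q_nonneg le_less_trans)
    have "ennreal (LINT x|?M. q x) = (\<integral>\<^sup>+x. ennreal (q x) \<partial>?M)"
      using q_int by (intro nn_integral_eq_integral[symmetric]) (auto simp: q_nonneg)
    then have "ennreal (LINT x|?M. q x) \<le> ennreal (pi\<^sup>2 / 2 * (L2_norm \<Omega> Dv)\<^sup>2)"
      using hardy by (simp only:)
    then have q_le: "(LINT x|?M. q x) \<le> pi\<^sup>2 / 2 * (L2_norm \<Omega> Dv)\<^sup>2"
      by (subst (asm) ennreal_le_iff) simp_all
    define b where "b x = \<delta> / C / 2 * (q x + (norm (Dv x))\<^sup>2)" for x
    have b_int: "integrable ?M b"
      unfolding b_def using q_int Dv_int by simp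
    have le_b: "\<bar>convection_integrand v Dv u x\<bar> \<le> b x" if x: "x \<in> \<Omega>" for x
    proof -
      have "ereal (norm x * norm (u x)) \<le> ereal (\<delta> / C)"
        using SUP_upper[OF x, of "\<lambda>x. ereal (norm x * norm (u x))"] sup by (rule order_trans)
      then have ux: "norm x * norm (u x) \<le> \<delta> / C" by simp
      have "\<bar>convection_integrand v Dv u x\<bar> \<le> norm (u x) * (norm (Dv x) * norm (v x))"
        by (rule abs_convection_integrand_le)
      \<comment> \<open>The weight |x| is shifted from \<open>v\<close> to \<open>u\<close>, which
        is possible because 0 lies in the obstacle.\<close>
      also have "\<dots> = (norm x * norm (u x)) * (norm (v x) / norm x * norm (Dv x))"
        using \<Omega>0[OF x] by simp
      also have "\<dots> \<le> \<delta> / C * (norm (v x) / norm x * norm (Dv x))"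
        by (intro mult_right_mono ux) simp
      also have "\<dots> \<le> \<delta> / C * ((q x + (norm (Dv x))\<^sup>2) / 2)"
      proof (rule mult_left_mono)
        have "2 * (norm (v x) / norm x * norm (Dv x)) \<le> q x + (norm (Dv x))\<^sup>2"
          using sum_squares_bound[of "norm (v x) / norm x" "norm (Dv x)"] by (simp only: q_def mult.assoc)
        then show "norm (v x) / norm x * norm (Dv x) \<le> (q x + (norm (Dv x))\<^sup>2) / 2"
          by (subst le_divide_eq_numeral1(1), subst mult.commute)
      qed (use \<delta> C in simp)
      finally show ?thesis
        by (simp add: b_def)
    qed
    have c_meas: "convection_integrand v Dv u \<in> borel_measurable ?M"
      unfolding convection_integrand_def[abs_def]
      by (intro borel_measurable_sum borel_measurable_times borel_measurable_component v_meas Dv_meas u)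
    have c_int: "integrable ?M (convection_integrand v Dv u)"
    proof (rule Bochner_Integration.integrable_bound[OF b_int c_meas], rule AE_I2)
      fix x assume "x \<in> space ?M"
      then have "\<bar>convection_integrand v Dv u x\<bar> \<le> b x"
        by (intro le_b) simp
      then show "norm (convection_integrand v Dv u x) \<le> norm (b x)"
        by simp
    qed
    have "\<bar>LINT x|?M. convection_integrand v Dv u x\<bar> \<le> (LINT x|?M. \<bar>convection_integrand v Dv u x\<bar>)"
      by (rule integral_abs_bound)
    also have "\<dots> \<le> (LINT x|?M. b x)"
      using c_int b_int le_b by (intro integral_mono) auto
    also have "\<dots> = \<delta> / C / 2 * ((LINT x|?M. q x) + (L2_norm \<Omega> Dv)\<^sup>2)"
      unfolding b_def using q_int Dv_int by (simp add: Dv_norm)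
    also have "\<dots> \<le> \<delta> / C / 2 * (pi\<^sup>2 / 2 * (L2_norm \<Omega> Dv)\<^sup>2 + (L2_norm \<Omega> Dv)\<^sup>2)"
      using q_le \<delta> C by (intro mult_left_mono add_right_mono) auto
    also have "\<dots> = \<delta> / C * (C * (L2_norm \<Omega> Dv)\<^sup>2)"
      by (simp add: C_def algebra_simps add_divide_distrib)
    also have "\<dots> = \<delta> * (L2_norm \<Omega> Dv)\<^sup>2"
      using C by simp
    finally show ?thesis
      using c_int by blast
  qed
  with C show ?thesis by blast
qed

end
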